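(* Let $V_1,\dots,V_m\in\mathbb{C}^{n\times n}$ satisfy $\sum_{i=1}^mV_i^*V_i=I_n$ and let $\Phi(X)=\sum_{i=1}^mV_i^*XV_i$ on the space $\mathbf{S}_n$ of $n\times n$ Hermitian matrices. Define complex subspaces of $\mathbb{C}^{n\times n}$ by $$\mathcal{H}_0=\operatorname{span}\{I_n\},\qquad \mathcal{H}_{k+1}=\operatorname{span}\{V_i^*XV_j:\ X\in\mathcal{H}_k,\ i,j=1,\dots,m\},\quad k=0,1,\dots,$$ and let $\mathcal{G}_k$ be the orthogonal complement of $\mathcal{H}_k$ in $\mathbb{C}^{n\times n}$. The following conditions are equivalent: (1) There exists $k$ such that $\|\Phi^k\|_H<1$. (2) Every orbit of the system $X_{k+1}=\Phi(X_k)$, $k=1,2,\dots$ (in $\mathbf{S}_n$), converges to an equilibrium co-linear to $I_n$ (i.e. a real scalar multiple of $I_n$). (3) The subspace $\bigcap_k\mathcal{G}_k$ does not contain a rank one matrix. (4) There exists $k_0\le n^2-1$ such that $\|\Phi^{k_0}\|_H<1$.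
   Context: $k,k_0$ range over nonnegative integers. For a linear map $F:\mathbf{S}_n\to\mathbf{S}_n$ with $F(I_n)=I_n$, $$\|F\|_H=\sup_{X\in\mathbf{S}_n\setminus\mathbb{R}I_n}\frac{\lambda_{\max}(F(X))-\lambda_{\min}(F(X))}{\lambda_{\max}(X)-\lambda_{\min}(X)}$$ (with value $0$ if $n=1$), i.e. the operator norm on $\mathbf{S}_n/\mathbb{R}I_n$ for the norm $\|X\|_H=\lambda_{\max}(X)-\lambda_{\min}(X)$. $\Phi^k$ is the $k$-th iterate of $\Phi$. Orthogonality in $\mathbb{C}^{n\times n}$ is with respect to the inner product $(A,B)\mapsto\operatorname{trace}(A^*B)$. *)

theory Defs
  imports "HOL-Analysis.Analysis"
begin

definition ctranspose :: "complex^'n^'m \<Rightarrow> complex^'m^'n"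
  where "ctranspose A = (\<chi> i j. cnj (A $ j $ i))"

definition Herm :: "(complex^'n^'n) set"
  where "Herm = {A. ctranspose A = A}"

definition eigenvalues :: "complex^'n^'n \<Rightarrow> complex set"
  where "eigenvalues A = {c. \<exists>v. v \<noteq> 0 \<and> A *v v = c *s v}"

(* Only meant for Hermitian arguments, whose eigenvalues are real (and which form a
   finite nonempty set), so that taking real parts is a mere change of type. *)
definition lambda_max :: "complex^'n^'n \<Rightarrow> real"
  where "lambda_max A = Max (Re ` eigenvalues A)"

definition lambda_min :: "complex^'n^'n \<Rightarrow> real"
  where "lambda_min A = Min (Re ` eigenvalues A)"

(* Real multiples of the identity, as a subset of the Hermitian matrices. *)
definition real_scalars :: "(complex^'n^'n) set"
  where "real_scalars = range (\<lambda>r::real. r *\<^sub>R mat 1)"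

(* Meant for F restricting to a real-linear self-map of Herm with F (mat 1) = mat 1; the quotients
   are then bounded. If the dimension is 1, the index set of the supremum is empty. *)
definition hnorm :: "(complex^'n^'n \<Rightarrow> complex^'n^'n) \<Rightarrow> real"
  where "hnorm F =
    (if CARD('n) = 1 then 0
     else (SUP X \<in> Herm - real_scalars.
             (lambda_max (F X) - lambda_min (F X)) / (lambda_max X - lambda_min X)))"

(* Complex scaling of matrices: the library's *s, at a matrix type, would scale the rows
   by vectors instead of scaling by numbers. *)
definition cscale :: "complex \<Rightarrow> complex^'n^'m \<Rightarrow> complex^'n^'m"
  where "cscale c A = (\<chi> i j. c * A $ i $ j)"

global_interpretation cmatrix: vector_space "cscale :: complex \<Rightarrow> complex^'n^'m \<Rightarrow> complex^'n^'m"
  by unfold_locales (simp_all add: cscale_def vec_eq_iff algebra_simps)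

definition trace_inner :: "complex^'n^'n \<Rightarrow> complex^'n^'n \<Rightarrow> complex"
  where "trace_inner A B = trace (ctranspose A ** B)"

definition orth_compl :: "(complex^'n^'n) set \<Rightarrow> (complex^'n^'n) set"
  where "orth_compl S = {A. \<forall>B\<in>S. trace_inner B A = 0}"

definition kraus_map :: "(nat \<Rightarrow> complex^'n^'n) \<Rightarrow> nat \<Rightarrow> complex^'n^'n \<Rightarrow> complex^'n^'n"
  where "kraus_map V m X = (\<Sum>i = 1..m. ctranspose (V i) ** X ** V i)"

primrec Hspace :: "(nat \<Rightarrow> complex^'n^'n) \<Rightarrow> nat \<Rightarrow> nat \<Rightarrow> (complex^'n^'n) set"
  where
    "Hspace V m 0 = cmatrix.span {mat 1}"
  | "Hspace V m (Suc k) =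
       cmatrix.span {ctranspose (V i) ** X ** V j |X i j.
                       X \<in> Hspace V m k \<and> i \<in> {1..m} \<and> j \<in> {1..m}}"

definition Gspace :: "(nat \<Rightarrow> complex^'n^'n) \<Rightarrow> nat \<Rightarrow> nat \<Rightarrow> (complex^'n^'n) set"
  where "Gspace V m k = orth_compl (Hspace V m k)"

end

theory Submission
  imports Defs
begin

text \<open>The proof runs around the cycle (1) \<open>\<Longrightarrow>\<close> (2) \<open>\<Longrightarrow>\<close> (3) \<open>\<Longrightarrow>\<close> (4) \<open>\<Longrightarrow>\<close> (1), whose last arrow is trivial. The common
thread is that the \<open>k\<close>-th iterate is \<open>X \<mapsto> \<Sum> W\<^sup>* X W\<close> with \<open>W\<close> ranging over the products of \<open>k\<close> of the given
matrices, and that \<open>\<H>\<^sub>k\<close> is spanned by the matrices \<open>W\<^sup>* W'\<close>. A rank one matrix \<open>v u\<^sup>*\<close> therefore lies in \<open>\<G>\<^sub>k\<close>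
exactly if every \<open>W u\<close> is orthogonal to every \<open>W' v\<close> (\<open>outer_in_Gspace_iff\<close>). Extreme eigenvalues of a
Hermitian matrix are extreme values of its quadratic form on the unit sphere, and
\<open>\<langle>x, F X x\<rangle> = \<Sum> \<langle>W x, X W x\<rangle>\<close> for the iterate \<open>F\<close>, so everything is expressed through quadratic forms.

(1) \<open>\<Longrightarrow>\<close> (2), \<open>contraction_imp_convergence\<close>: extreme eigenvalues are monotone along an orbit, and
a strict contraction of their difference by some iterate forces them to a common limit.

(2) \<open>\<Longrightarrow>\<close> (3), \<open>orth_words_not_convergent\<close>: a rank one matrix \<open>v u\<^sup>*\<close> in all \<open>\<G>\<^sub>k\<close> yields, with \<open>u\<close> and \<open>v\<close> normalised, two states \<open>u u\<^sup>*\<close> and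
\<open>v v\<^sup>*\<close> whose images under the iterated adjoint map stay orthogonal to each other. Convergence of
all orbits to scalars would make their difference tend to 0, although each keeps trace 1.

(3) \<open>\<Longrightarrow>\<close> (4): unitality makes the spaces \<open>\<H>\<^sub>k\<close> increase, and since each determines the next, they are constant
from \<open>k = n\<^sup>2 - 1\<close> on (\<open>Hspace_stabilises\<close>); hence \<open>\<G>\<^sub>k\<close> for this \<open>k\<close> already contains no rank one matrix. If
\<open>n \<ge> 2\<close> and this iterate were not a strict contraction, then by compactness of the order interval \<open>0 \<le> X \<le> I\<close> there would be
some such \<open>X\<close> and unit vectors \<open>u\<close>, \<open>v\<close> with \<open>\<langle>u, F X u\<rangle> = 1\<close> and \<open>\<langle>v, F X v\<rangle> = 0\<close>. Then \<open>X\<close> fixes every \<open>W u\<close> and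
annihilates every \<open>W' v\<close>, which makes them orthogonal (\<open>hnorm_less_1_if_no_orthogonal_words\<close>).
For \<open>n = 1\<close> the norm is 0 by convention, already for the exponent \<open>0 = n\<^sup>2 - 1\<close>.\<close>

section \<open>Quadratic forms and rank one matrices\<close>

text \<open>The library's inner product on \<open>complex^'n\<close> is the real part of this one. The real inner product
suffices wherever only quadratic forms of Hermitian matrices occur; the complex one is needed to
express orthogonality to complex subspaces.\<close>

definition cinner :: "complex^'n \<Rightarrow> complex^'n \<Rightarrow> complex"
  where "cinner x y = (\<Sum>i\<in>UNIV. cnj (x $ i) * y $ i)"

definition qform :: "complex^'n^'n \<Rightarrow> complex^'n \<Rightarrow> real"
  where "qform A x = x \<bullet> (A *v x)"

definition outer :: "complex^'m \<Rightarrow> complex^'n \<Rightarrow> complex^'n^'m"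
  where "outer x y = (\<chi> i j. x $ i * cnj (y $ j))"

lemma inner_eq_Re_cinner: "x \<bullet> y = Re (cinner x y)"
  by (simp add: cinner_def inner_vec_def inner_complex_def)

lemma cinner_commute: "cinner y x = cnj (cinner x y)"
  by (simp add: cinner_def mult.commute)

lemma cinner_adjoint: "cinner (A *v x) y = cinner x (ctranspose A *v y)"
  unfolding cinner_def matrix_vector_mult_def ctranspose_def
  by (simp add: sum_distrib_left sum_distrib_right) (subst sum.swap, simp add: mult_ac)

lemma cscale_mult_vec: "cscale c A *v x = c *s (A *v x)"
  by (simp add: cscale_def matrix_vector_mult_def vec_eq_iff sum_distrib_left mult.assoc)

lemma cinner_add_left: "cinner (x + y) z = cinner x z + cinner y z"
  by (simp add: cinner_def algebra_simps sum.distrib)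

lemma cinner_scale_left: "cinner (c *s x) z = cnj c * cinner x z"
  by (simp add: cinner_def sum_distrib_left mult.assoc)

lemma ctranspose_ctranspose [simp]: "ctranspose (ctranspose A) = A"
  by (simp add: ctranspose_def)

lemma ctranspose_mult: "ctranspose (A ** B) = ctranspose B ** ctranspose A"
  by (simp add: ctranspose_def matrix_matrix_mult_def vec_eq_iff mult.commute)

lemma ctranspose_add: "ctranspose (A + B) = ctranspose A + ctranspose B"
  by (simp add: ctranspose_def vec_eq_iff)

lemma ctranspose_diff: "ctranspose (A - B) = ctranspose A - ctranspose B"
  by (simp add: ctranspose_def vec_eq_iff)

lemma ctranspose_minus: "ctranspose (- A) = - ctranspose A"
  by (simp add: ctranspose_def vec_eq_iff)

lemma ctranspose_scaleR: "ctranspose (r *\<^sub>R A) = r *\<^sub>R ctranspose A"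
  by (simp add: ctranspose_def vec_eq_iff)

lemma ctranspose_sum: "ctranspose (\<Sum>i\<in>I. f i) = (\<Sum>i\<in>I. ctranspose (f i))"
  by (simp add: ctranspose_def vec_eq_iff)

lemma ctranspose_mat_1 [simp]: "ctranspose (mat 1) = mat 1"
  by (simp add: ctranspose_def mat_def vec_eq_iff)

lemma inner_adjoint: "(A *v x) \<bullet> y = x \<bullet> (ctranspose A *v y)"
  by (simp add: inner_eq_Re_cinner cinner_adjoint)

lemma Herm_iff: "A \<in> Herm \<longleftrightarrow> ctranspose A = A"
  by (simp add: Herm_def)

lemma cscale_real_vec: "complex_of_real r *s x = r *\<^sub>R (x :: complex^'n)"
  by (simp add: vec_eq_iff scaleR_conv_of_real[where 'a=complex])

lemma scaleR_mult_vec: "(r *\<^sub>R A :: complex^'n^'m) *v x = r *\<^sub>R (A *v x)"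
  by (simp add: matrix_vector_mult_def vec_eq_iff scaleR_sum_right)

lemma mult_vec_scaleR: "(A :: complex^'n^'m) *v (r *\<^sub>R x) = r *\<^sub>R (A *v x)"
  by (simp add: matrix_vector_mult_def vec_eq_iff scaleR_sum_right)

lemma scaleR_mat_1_mult_vec: "(r *\<^sub>R mat 1 :: complex^'n^'n) *v x = r *\<^sub>R x"
  by (simp add: scaleR_mult_vec)

lemma qform_add: "qform (A + B) x = qform A x + qform B x"
  by (simp add: qform_def matrix_vector_mult_add_rdistrib inner_right_distrib)

lemma qform_diff: "qform (A - B) x = qform A x - qform B x"
  by (simp add: qform_def matrix_vector_mult_diff_rdistrib inner_diff_right)

lemma qform_minus: "qform (- A) x = - qform A x"
  using qform_diff[of 0 A x] by (simp add: qform_def)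

lemma qform_scaleR: "qform (r *\<^sub>R A) x = r * qform A x"
  by (simp add: qform_def scaleR_mult_vec)

lemma qform_sum: "qform (\<Sum>i\<in>I. f i) x = (\<Sum>i\<in>I. qform (f i) x)"
  by (induction I rule: infinite_finite_induct) (simp_all add: qform_add, simp_all add: qform_def)

lemma qform_mat_1: "qform (mat 1) x = (norm x)\<^sup>2"
  by (simp add: qform_def power2_norm_eq_inner)

text \<open>Only the Hermitian part of a matrix contributes to its (real) quadratic form.\<close>

lemma qform_ctranspose: "qform (ctranspose A) x = qform A x"
  by (simp add: qform_def inner_adjoint[symmetric] inner_commute)

lemma qform_scale_vec: "qform A (c *\<^sub>R x) = c\<^sup>2 * qform A x"
  by (simp add: qform_def mult_vec_scaleR power2_eq_square)

lemma qform_conj: "qform (ctranspose W ** X ** W) x = qform X (W *v x)"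
  by (simp add: qform_def matrix_vector_mul_assoc[symmetric] inner_adjoint)

lemma qform_polarization:
  assumes "A \<in> Herm"
  shows "x \<bullet> (A *v y) = (qform A (x + y) - qform A x - qform A y) / 2"
proof -
  have "y \<bullet> (A *v x) = x \<bullet> (A *v y)"
    using assms inner_adjoint[of A x y] by (simp add: Herm_iff inner_commute)
  then show ?thesis
    by (simp add: qform_def matrix_vector_right_distrib inner_left_distrib inner_right_distrib)
qed

text \<open>Together with polarization this reduces every entrywise statement about Hermitian matrices
(equality, convergence, boundedness) to one about their quadratic forms.\<close>

lemma inner_Basis_eq_entry:
  assumes "b \<in> (Basis :: (complex^'n^'n) set)"
  obtains x y :: "complex^'n" where "norm x = 1" "norm y = 1" "\<And>A. A \<bullet> b = x \<bullet> (A *v y)"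
proof -
  obtain i j c where b: "b = axis i (axis j c)" and c: "c \<in> (Basis :: complex set)"
    using assms by (auto simp: Basis_vec_def)
  have "norm (axis i c :: complex^'n) = 1" "norm (axis j 1 :: complex^'n) = 1"
    using c by (simp_all add: norm_eq_1 inner_axis_axis)
  moreover have "A \<bullet> b = axis i c \<bullet> (A *v axis j 1)" for A
    by (simp add: b inner_axis inner_axis' inner_commute)
      (simp add: matrix_vector_mult_def axis_def if_distrib cong: if_cong)
  ultimately show thesis by (rule that)
qed

lemma outer_inner: "outer x y \<bullet> X = x \<bullet> (X *v y)"
  by (simp add: outer_def inner_vec_def matrix_vector_mult_def inner_sum_right inner_complex_def
       sum_distrib_left algebra_simps sum.distrib sum_subtractf)

text \<open>Quadratic forms are the real linear functionals represented by the matrices \<open>x x\<^sup>*\<close>; this is the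
duality that turns statements about orbits into statements about sums of such matrices.\<close>

lemma outer_self_inner: "outer x x \<bullet> X = qform X x"
  by (simp add: outer_inner qform_def)

lemma outer_mult_vec: "outer x y *v z = cinner y z *s x"
  by (simp add: outer_def cinner_def matrix_vector_mult_def vec_eq_iff sum_distrib_left mult_ac)

lemma trace_inner_outer: "trace_inner B (outer v u) = cinner (B *v u) v"
  unfolding trace_inner_def trace_def cinner_def outer_def ctranspose_def matrix_matrix_mult_def
    matrix_vector_mult_def
  by (simp add: sum_distrib_left sum_distrib_right) (subst sum.swap, simp add: mult_ac)

lemma rank_outer:
  assumes "v \<noteq> 0" "u \<noteq> 0"
  shows "rank (outer v u) = 1"
proof -
  define w where "w = (\<chi> j. cnj (u $ j))"
  have w: "w \<noteq> 0" using assms(2) by (auto simp: w_def vec_eq_iff)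
  have row: "row i (outer v u) = v $ i *s w" for i
    by (simp add: row_def outer_def w_def vec_eq_iff)
  obtain i where i: "v $ i \<noteq> 0" using assms(1) by (auto simp: vec_eq_iff)
  have sp: "vec.span (rows (outer v u)) = vec.span {w}"
  proof (rule vec.span_eq[THEN iffD2], intro conjI)
    show "rows (outer v u) \<subseteq> vec.span {w}"
      by (auto simp: rows_def row intro: vec.span_scale vec.span_base)
    have "w = inverse (v $ i) *s row i (outer v u)"
      using i by (simp add: row)
    moreover have "row i (outer v u) \<in> vec.span (rows (outer v u))"
      by (rule vec.span_base) (auto simp: rows_def)
    ultimately show "{w} \<subseteq> vec.span (rows (outer v u))"
      by (metis empty_subsetI insert_subset vec.span_scale)
  qed
  have "rank (outer v u) = vec.dim {w}"
    unfolding row_rank_def_gen using sp by (metis vec.dim_span)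
  also have "\<dots> = 1" using w by (simp add: vec.dim_eq_card_independent)
  finally show ?thesis .
qed

lemma rank_1_is_outer:
  assumes "rank (A :: complex^'n^'m) = 1"
  obtains v u where "v \<noteq> 0" "u \<noteq> 0" "A = outer v u"
proof -
  have dim: "vec.dim (rows A) = 1" using assms by (simp add: row_rank_def_gen)
  obtain B where B: "B \<subseteq> rows A" "vec.independent B" "rows A \<subseteq> vec.span B" "card B = 1"
    using vec.basis_exists[of "rows A"] dim by metis
  then obtain w where w: "B = {w}" using card_1_singletonE by blast
  have "\<exists>c. row i A = c *s w" for i
    using B(3) w by (auto simp: rows_def vec.span_singleton)
  then obtain c where c: "\<And>i. row i A = c i *s w" by metis
  define v where "v = (\<chi> i. c i)"
  define u where "u = (\<chi> j. cnj (w $ j))"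
  have A: "A = outer v u"
    using c by (simp add: outer_def v_def u_def vec_eq_iff row_def)
  have w0: "w \<noteq> 0" using B(2) w vec.dependent_zero by blast
  have "u \<noteq> 0" using w0 by (auto simp: u_def vec_eq_iff)
  moreover have "v \<noteq> 0"
  proof
    assume "v = 0"
    then have "c i = 0" for i by (auto simp: v_def vec_eq_iff)
    then have "rows A \<subseteq> {0}" using c by (auto simp: rows_def)
    then show False using dim vec.dim_subset[of "rows A" "{0}"] by simp
  qed
  ultimately show thesis using A that by blast
qed

text \<open>At a zero \<open>x\<close> of a nonnegative form the form is minimal, so its first variation in the
direction \<open>A x\<close> vanishes. Applied to \<open>\<mu> I - A\<close> it produces eigenvectors from extremal vectors, and
applied to \<open>X\<close> and \<open>I - X\<close> it identifies the equality case of the contraction estimate.\<close>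

lemma semidefinite_kernel:
  assumes A: "A \<in> Herm" and nonneg: "\<And>y. 0 \<le> qform A y" and zero: "qform A x = 0"
  shows "A *v x = 0"
proof (rule ccontr)
  assume ne: "A *v x \<noteq> 0"
  define z where "z = A *v x"
  define p where "p = z \<bullet> z"
  define q where "q = qform A z"
  have p: "p > 0" using ne by (simp add: p_def z_def)
  have q: "q \<ge> 0" using nonneg by (simp add: q_def)
  have expand: "qform A (x - t *\<^sub>R z) = t\<^sup>2 * q - 2 * t * p" for t
  proof -
    have "(x \<bullet> (A *v z)) = p"
      using A inner_adjoint[of A x z] by (simp add: Herm_iff p_def z_def)
    moreover have "z \<bullet> (A *v x) = p" by (simp add: p_def z_def)
    ultimately show ?thesis
      using zero unfolding qform_def q_def
      by (simp add: mult_vec_scaleR power2_eq_square algebra_simps)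
  qed
  \<comment> \<open>The increment \<open>t\<^sup>2 q - 2 t p\<close> is negative for every \<open>0 < t < 2 p / q\<close>; adding 1 to \<open>q\<close> covers \<open>q = 0\<close>.\<close>
  define t where "t = p / (q + 1)"
  have t: "t > 0" using p q by (simp add: t_def)
  have "t * q < p" using p q by (simp add: t_def divide_simps algebra_simps)
  then have "t * (t * q - 2 * p) < 0"
    using t p by (intro mult_pos_neg) auto
  then show False using nonneg[of "x - t *\<^sub>R z"] expand[of t]
    by (simp add: power2_eq_square algebra_simps)
qed

section \<open>Extreme eigenvalues of Hermitian matrices\<close>

lemma Herm_eigenvector:
  assumes A: "A \<in> Herm" and v: "A *v v = c *s v" "v \<noteq> 0"
  shows "A *v v = Re c *\<^sub>R v" and "qform A v = Re c * (norm v)\<^sup>2"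
proof -
  have scale: "cinner v (c *s v) = c * cinner v v" "cinner (c *s v) v = cnj c * cinner v v"
    by (simp_all add: cinner_def sum_distrib_left mult_ac)
  have "cinner v v \<noteq> 0"
    using v(2) inner_eq_Re_cinner[of v v] by (metis inner_eq_zero_iff zero_complex.simps(1))
  moreover have "c * cinner v v = cnj c * cinner v v"
    using cinner_adjoint[of A v v] A v(1) scale unfolding Herm_iff by metis
  ultimately have "cnj c = c" by simp
  then have c: "c = complex_of_real (Re c)"
    by (simp add: complex_eq_iff)
  show *: "A *v v = Re c *\<^sub>R v"
    using v(1) c cscale_real_vec by metis
  show "qform A v = Re c * (norm v)\<^sup>2"
    by (simp add: qform_def * power2_norm_eq_inner)
qed

text \<open>Eigenvectors of a Hermitian matrix for distinct eigenvalues are orthogonal, hence linearly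
independent, in the real Euclidean space \<open>complex^'n\<close>. Finiteness is what gives \<open>Max\<close> and \<open>Min\<close> in
the definitions of \<open>lambda_max\<close> and \<open>lambda_min\<close> their meaning.\<close>

lemma finite_eigenvalues_Herm:
  assumes A: "A \<in> Herm"
  shows "finite (Re ` eigenvalues A)"
proof -
  have "\<exists>v. v \<noteq> 0 \<and> A *v v = r *\<^sub>R v" if "r \<in> Re ` eigenvalues A" for r
    using that Herm_eigenvector(1)[OF A] by (auto simp: eigenvalues_def)
  then obtain e where e: "\<And>r. r \<in> Re ` eigenvalues A \<Longrightarrow> e r \<noteq> 0 \<and> A *v e r = r *\<^sub>R e r"
    by metis
  let ?E = "Re ` eigenvalues A"
  have orth: "e r \<bullet> e s = 0" if "r \<in> ?E" "s \<in> ?E" "r \<noteq> s" for r s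
  proof -
    have "r * (e r \<bullet> e s) = s * (e r \<bullet> e s)"
      using inner_adjoint[of A "e r" "e s"] A e[OF that(1)] e[OF that(2)] by (simp add: Herm_iff)
    then show ?thesis using that(3) by simp
  qed
  have inj: "inj_on e ?E"
    by (rule inj_onI) (metis e inner_eq_zero_iff orth)
  have "pairwise orthogonal (e ` ?E)"
    by (auto simp: pairwise_def orthogonal_def intro!: orth)
  moreover have "0 \<notin> e ` ?E" using e by force
  ultimately have "finite (e ` ?E)"
    using pairwise_orthogonal_independent independent_imp_finite by blast
  then show ?thesis using inj finite_imageD by blast
qed

lemma continuous_qform: "continuous_on S (\<lambda>x. qform A x)"
  unfolding qform_def
  by (intro continuous_intros linear_continuous_on matrix_vector_mul_bounded_linear)

text \<open>A maximiser of the quadratic form on the unit sphere is an eigenvector, because it lies in the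
kernel of the semidefinite matrix \<open>\<mu> I - A\<close>, where \<open>\<mu>\<close> is the maximum.\<close>

lemma Herm_max_eigenvalue:
  fixes A :: "complex^'n^'n"
  assumes A: "A \<in> Herm"
  obtains z where "norm z = 1" "qform A z \<in> Re ` eigenvalues A"
    "\<And>y. qform A y \<le> qform A z * (norm y)\<^sup>2"
proof -
  have "sphere (0 :: complex^'n) 1 \<noteq> {}" by simp
  then obtain z where z: "norm z = 1" and max: "\<And>y. norm y = 1 \<Longrightarrow> qform A y \<le> qform A z"
    using continuous_attains_sup[OF compact_sphere _ continuous_qform, of 0 1 A] by auto
  define \<mu> where "\<mu> = qform A z"
  have bound: "qform A y \<le> \<mu> * (norm y)\<^sup>2" for y
  proof (cases "y = 0")
    case True then show ?thesis by (simp add: qform_def)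
  next
    case False
    then have "qform A ((1 / norm y) *\<^sub>R y) \<le> \<mu>"
      unfolding \<mu>_def by (intro max) simp
    then show ?thesis
      using False by (simp add: qform_scale_vec field_simps)
  qed
  have "(\<mu> *\<^sub>R mat 1 - A) *v z = 0"
  proof (rule semidefinite_kernel)
    show "\<mu> *\<^sub>R mat 1 - A \<in> Herm"
      using A by (simp add: Herm_iff ctranspose_diff ctranspose_scaleR)
    show "0 \<le> qform (\<mu> *\<^sub>R mat 1 - A) y" for y
      using bound[of y] by (simp add: qform_diff qform_scaleR qform_mat_1)
    show "qform (\<mu> *\<^sub>R mat 1 - A) z = 0"
      by (simp add: qform_diff qform_scaleR qform_mat_1 z \<mu>_def)
  qed
  then have "A *v z = complex_of_real \<mu> *s z"
    by (simp add: matrix_vector_mult_diff_rdistrib scaleR_mat_1_mult_vec cscale_real_vec)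
  moreover have "z \<noteq> 0" using z by auto
  ultimately have "complex_of_real \<mu> \<in> eigenvalues A"
    unfolding eigenvalues_def by blast
  then have "\<mu> \<in> Re ` eigenvalues A" by force
  then show thesis using z bound that by (simp add: \<mu>_def)
qed

lemma eigenvalue_Rayleigh:
  assumes A: "A \<in> Herm" and r: "r \<in> Re ` eigenvalues A"
  obtains v where "v \<noteq> 0" "qform A v = r * (norm v)\<^sup>2"
  using r Herm_eigenvector(2)[OF A] by (auto simp: eigenvalues_def)

lemma lambda_max_Rayleigh:
  assumes A: "A \<in> Herm"
  shows "\<exists>x. norm x = 1 \<and> qform A x = lambda_max A"
    and "qform A x \<le> lambda_max A * (norm x)\<^sup>2"
proof -
  obtain z where z: "norm z = 1" "qform A z \<in> Re ` eigenvalues A"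
    "\<And>y. qform A y \<le> qform A z * (norm y)\<^sup>2"
    using Herm_max_eigenvalue[OF A] by blast
  have "r \<le> qform A z" if r: "r \<in> Re ` eigenvalues A" for r
    using eigenvalue_Rayleigh[OF A r] z(3) by (metis mult_right_le_imp_le zero_less_norm_iff zero_less_power)
  then have "lambda_max A = qform A z"
    unfolding lambda_max_def using finite_eigenvalues_Herm[OF A] z(2) by (intro Max_eqI) auto
  then show "\<exists>x. norm x = 1 \<and> qform A x = lambda_max A" "qform A x \<le> lambda_max A * (norm x)\<^sup>2"
    using z by auto
qed

lemma lambda_min_Rayleigh:
  assumes A: "A \<in> Herm"
  shows "\<exists>x. norm x = 1 \<and> qform A x = lambda_min A"
    and "lambda_min A * (norm x)\<^sup>2 \<le> qform A x"
proof -
  have "- A \<in> Herm" using A by (simp add: Herm_iff ctranspose_minus)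
  then obtain z where z: "norm z = 1" "qform (- A) z \<in> Re ` eigenvalues (- A)"
    "\<And>y. qform (- A) y \<le> qform (- A) z * (norm y)\<^sup>2"
    using Herm_max_eigenvalue by blast
  obtain c v where v: "qform (- A) z = Re c" "v \<noteq> 0" "(- A) *v v = c *s v"
    using z(2) by (auto simp: eigenvalues_def)
  have "A *v v = (- c) *s v"
    using v(3) matrix_vector_mult_diff_rdistrib[of 0 A v] by (simp add: vec_eq_iff minus_equation_iff)
  then have "- c \<in> eigenvalues A" using v(2) by (auto simp: eigenvalues_def)
  then have mem: "qform A z \<in> Re ` eigenvalues A"
    using v(1) by (force simp: qform_minus)
  have low: "qform A z * (norm y)\<^sup>2 \<le> qform A y" for y
    using z(3)[of y] by (simp add: qform_minus)
  have "qform A z \<le> r" if r: "r \<in> Re ` eigenvalues A" for r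
    using eigenvalue_Rayleigh[OF A r] low by (metis mult_right_le_imp_le zero_less_norm_iff zero_less_power)
  then have "lambda_min A = qform A z"
    unfolding lambda_min_def using finite_eigenvalues_Herm[OF A] mem by (intro Min_eqI) auto
  then show "\<exists>x. norm x = 1 \<and> qform A x = lambda_min A" "lambda_min A * (norm x)\<^sup>2 \<le> qform A x"
    using z(1) low by auto
qed

section \<open>Oscillation\<close>

text \<open>The Hilbert seminorm \<open>\<parallel>A\<parallel>\<^sub>H\<close> on Hermitian matrices, whose kernel is the line of real scalar matrices.\<close>

definition osc :: "complex^'n^'n \<Rightarrow> real"
  where "osc A = lambda_max A - lambda_min A"

lemma qform_unit_bounds:
  assumes "A \<in> Herm" "norm x = 1"
  shows "lambda_min A \<le> qform A x" "qform A x \<le> lambda_max A"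
  using lambda_max_Rayleigh(2)[OF assms(1), of x] lambda_min_Rayleigh(2)[OF assms(1), of x] assms(2)
  by simp_all

lemma osc_attained:
  assumes "A \<in> Herm"
  obtains x y where "norm x = 1" "norm y = 1" "osc A = qform A x - qform A y"
  using lambda_max_Rayleigh(1)[OF assms] lambda_min_Rayleigh(1)[OF assms] unfolding osc_def by metis

lemma lambda_min_le_lambda_max: "A \<in> Herm \<Longrightarrow> lambda_min A \<le> lambda_max A"
  using lambda_max_Rayleigh(1) qform_unit_bounds(1) by metis

lemma Herm_eqI:
  fixes A B :: "complex^'n^'n"
  assumes "A \<in> Herm" "B \<in> Herm" "\<And>x. qform A x = qform B x"
  shows "A = B"
proof (rule euclidean_eqI)
  fix b :: "complex^'n^'n" assume "b \<in> Basis"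
  then obtain x y :: "complex^'n" where "\<And>A. A \<bullet> b = x \<bullet> (A *v y)"
    using inner_Basis_eq_entry by metis
  then show "A \<bullet> b = B \<bullet> b"
    using assms by (simp add: qform_polarization)
qed

lemma Herm_tendstoI:
  fixes Y :: "nat \<Rightarrow> complex^'n^'n"
  assumes "\<And>j. Y j \<in> Herm" "E \<in> Herm" "\<And>x. (\<lambda>j. qform (Y j) x) \<longlonglongrightarrow> qform E x"
  shows "Y \<longlonglongrightarrow> E"
proof (subst tendsto_componentwise_iff, intro ballI)
  fix b :: "complex^'n^'n" assume "b \<in> Basis"
  then obtain x y :: "complex^'n" where b: "\<And>A. A \<bullet> b = x \<bullet> (A *v y)"
    using inner_Basis_eq_entry by metis
  show "(\<lambda>j. Y j \<bullet> b) \<longlonglongrightarrow> E \<bullet> b"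
    unfolding b qform_polarization[OF assms(1)] qform_polarization[OF assms(2)]
    by (intro tendsto_intros assms(3)) simp
qed

lemma scaleR_mat_1_Herm: "r *\<^sub>R mat 1 \<in> Herm"
  by (simp add: Herm_iff ctranspose_scaleR)

lemma real_scalars_Herm: "real_scalars \<subseteq> Herm"
  by (auto simp: real_scalars_def scaleR_mat_1_Herm)

lemma qform_scalar: "qform (r *\<^sub>R mat 1) x = r * (norm x)\<^sup>2"
  by (simp add: qform_scaleR qform_mat_1)

lemma osc_scalar:
  assumes "A \<in> real_scalars" shows "osc A = 0"
proof -
  have H: "A \<in> Herm" using assms real_scalars_Herm by blast
  then obtain x y where "norm x = 1" "norm y = 1" "osc A = qform A x - qform A y"
    by (rule osc_attained)
  then show ?thesis using assms by (auto simp: real_scalars_def qform_scalar)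
qed

lemma osc_eq_0_imp_scalar:
  assumes A: "A \<in> Herm" and "osc A = 0"
  shows "A \<in> real_scalars"
proof -
  have "qform A x = qform (lambda_max A *\<^sub>R mat 1) x" for x
    using lambda_max_Rayleigh(2)[OF A, of x] lambda_min_Rayleigh(2)[OF A, of x] assms(2)
    by (simp add: qform_scalar osc_def)
  then have "A = lambda_max A *\<^sub>R mat 1"
    by (intro Herm_eqI A scaleR_mat_1_Herm)
  then show ?thesis unfolding real_scalars_def by blast
qed

lemma osc_nonneg: "A \<in> Herm \<Longrightarrow> 0 \<le> osc A"
  using lambda_min_le_lambda_max by (simp add: osc_def)

lemma osc_pos: "A \<in> Herm - real_scalars \<Longrightarrow> 0 < osc A"
  using osc_nonneg osc_eq_0_imp_scalar by force

lemma Herm_dim_1: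
  assumes "CARD('n) = 1" and A: "(A :: complex^'n^'n) \<in> Herm"
  shows "A \<in> real_scalars"
proof -
  obtain a where a: "(UNIV :: 'n set) = {a}" using assms(1) card_1_singletonE by blast
  have all: "i = a" for i :: 'n using a by auto
  have "cnj (A $ a $ a) = A $ a $ a"
    using A by (simp add: Herm_iff ctranspose_def vec_eq_iff)
  then have "A $ a $ a = complex_of_real (Re (A $ a $ a))" by (simp add: complex_eq_iff)
  then have "A $ i $ j = (Re (A $ a $ a) *\<^sub>R (mat 1 :: complex^'n^'n)) $ i $ j" for i j
    using all[of i] all[of j] by (simp add: mat_def scaleR_conv_of_real[where 'a=complex])
  then have "A = Re (A $ a $ a) *\<^sub>R mat 1" unfolding vec_eq_iff by blast
  then show ?thesis unfolding real_scalars_def by blast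
qed

lemma Herm_nonscalar_exists:
  assumes "CARD('n) \<noteq> 1"
  shows "(Herm - real_scalars :: (complex^'n^'n) set) \<noteq> {}"
proof -
  obtain i j :: 'n where ij: "i \<noteq> j"
    using assms by (metis UNIV_eq_I card_1_singleton_iff One_nat_def insertI1)
  define P where "P = outer (axis i 1 :: complex^'n) (axis i 1)"
  have "P \<in> Herm" by (simp add: P_def Herm_iff ctranspose_def outer_def mult.commute)
  moreover have "P \<notin> real_scalars"
  proof
    assume "P \<in> real_scalars"
    then obtain r where "P = r *\<^sub>R mat 1" by (auto simp: real_scalars_def)
    then have "P $ i $ i = P $ j $ j" by (simp add: mat_def)
    then show False using ij by (simp add: P_def outer_def axis_def)
  qed
  ultimately show ?thesis by blast
qed

text \<open>The order interval \<open>0 \<le> X \<le> I\<close>. Every nonscalar Hermitian matrix is carried into it by an affine map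
that divides oscillations by \<open>osc X\<close>, so a supremum of quotients of oscillations becomes a maximum over
a compact set.\<close>

definition effects :: "(complex^'n^'n) set"
  where "effects = {X \<in> Herm. \<forall>x. 0 \<le> qform X x \<and> qform X x \<le> (norm x)\<^sup>2}"

lemma continuous_qform_joint [continuous_intros]:
  assumes "continuous_on S f" "continuous_on S g"
  shows "continuous_on S (\<lambda>s. qform (f s) (g s))"
  unfolding qform_def matrix_vector_mult_def using assms by (intro continuous_intros) auto

lemma compact_effects: "compact (effects :: (complex^'n^'n) set)"
proof -
  have "closed (effects :: (complex^'n^'n) set)"
    unfolding effects_def Herm_def ctranspose_def Collect_conj_eq mem_Collect_eq
    by (intro closed_Int closed_Collect_all closed_Collect_conj closed_Collect_le closed_Collect_eq
        continuous_intros)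
  moreover have "bounded (effects :: (complex^'n^'n) set)"
    unfolding bounded_iff
  proof (intro exI ballI)
    fix X :: "complex^'n^'n" assume X: "X \<in> effects"
    have "\<bar>X \<bullet> b\<bar> \<le> 2" if "b \<in> Basis" for b
    proof -
      obtain x y :: "complex^'n" where n: "norm x = 1" "norm y = 1" and b: "X \<bullet> b = x \<bullet> (X *v y)"
        using inner_Basis_eq_entry[OF \<open>b \<in> Basis\<close>] by metis
      have q: "0 \<le> qform X z" "qform X z \<le> (norm z)\<^sup>2" for z
        using X by (auto simp: effects_def)
      have "norm (x + y) \<le> 2" using norm_triangle_ineq[of x y] n by simp
      then have "(norm (x + y))\<^sup>2 \<le> 2\<^sup>2" by (rule power_mono) simp
      then have "qform X (x + y) \<le> 4" using q(2)[of "x + y"] by simp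
      moreover have "x \<bullet> (X *v y) = (qform X (x + y) - qform X x - qform X y) / 2"
        using X by (intro qform_polarization) (simp add: effects_def)
      ultimately show ?thesis
        using q[of x] q[of y] q(1)[of "x + y"] n unfolding b by simp
    qed
    then have "(\<Sum>b\<in>Basis. \<bar>X \<bullet> b\<bar>) \<le> (\<Sum>b\<in>(Basis :: (complex^'n^'n) set). 2)"
      by (rule sum_mono)
    then show "norm X \<le> (\<Sum>b\<in>(Basis :: (complex^'n^'n) set). 2)"
      using norm_le_l1[of X] by linarith
  qed
  ultimately show ?thesis by (simp add: compact_eq_bounded_closed)
qed

lemma effects_normalisation:
  assumes X: "X \<in> Herm" and pos: "0 < osc X"
  shows "(1 / osc X) *\<^sub>R (X - lambda_min X *\<^sub>R mat 1) \<in> effects"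
proof -
  let ?Y = "(1 / osc X) *\<^sub>R (X - lambda_min X *\<^sub>R mat 1)"
  have "?Y \<in> Herm" using X by (simp add: Herm_iff ctranspose_scaleR ctranspose_diff)
  moreover have "0 \<le> qform ?Y x \<and> qform ?Y x \<le> (norm x)\<^sup>2" for x
    using lambda_max_Rayleigh(2)[OF X, of x] lambda_min_Rayleigh(2)[OF X, of x] pos
    by (simp add: qform_scaleR qform_diff qform_mat_1 divide_simps) (simp add: osc_def algebra_simps)
  ultimately show ?thesis by (simp add: effects_def)
qed

lemma effects_zero:
  assumes "X \<in> effects" "qform X x = 0" shows "X *v x = 0"
  using assms by (intro semidefinite_kernel) (auto simp: effects_def)

lemma effects_one:
  assumes X: "X \<in> effects" and "qform X x = (norm x)\<^sup>2" shows "X *v x = x"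
proof -
  have "(mat 1 - X) *v x = 0"
    using assms by (intro semidefinite_kernel)
      (auto simp: effects_def Herm_iff ctranspose_diff qform_diff qform_mat_1)
  then show ?thesis by (simp add: matrix_vector_mult_diff_rdistrib)
qed

text \<open>The form of an effect reaches its upper bound only at fixed vectors and its lower bound only at
vectors in the kernel, and these are eigenspaces of a Hermitian matrix for the eigenvalues 1 and 0.\<close>

lemma cinner_effects_eq_0:
  assumes X: "X \<in> effects" and x: "qform X x = (norm x)\<^sup>2" and y: "qform X y = 0"
  shows "cinner x y = 0"
proof -
  have "cinner x y = cinner (X *v x) y" using effects_one[OF X x] by simp
  also have "\<dots> = cinner x (X *v y)" using X by (simp add: cinner_adjoint effects_def Herm_iff)
  also have "\<dots> = 0" using effects_zero[OF X y] by (simp add: cinner_def)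
  finally show ?thesis .
qed

section \<open>Iterates of the Kraus map\<close>

definition words :: "nat \<Rightarrow> nat \<Rightarrow> nat list set"
  where "words m k = {w. set w \<subseteq> {1..m} \<and> length w = k}"

text \<open>The first letter acts first on vectors. This is the order in which both \<open>kraus_map V m ^^ k\<close> and
\<open>Hspace V m k\<close> unfold: the products of words of length \<open>k\<close> are Kraus operators of the \<open>k\<close>-th iterate, and
the matrices \<open>W\<^sup>* W'\<close> formed from them span \<open>Hspace V m k\<close>.\<close>

primrec wprod :: "(nat \<Rightarrow> complex^'n^'n) \<Rightarrow> nat list \<Rightarrow> complex^'n^'n"
  where
    "wprod V [] = mat 1"
  | "wprod V (i # w) = wprod V w ** V i"

lemma words_0: "words m 0 = {[]}"
  by (auto simp: words_def)

lemma words_Suc: "words m (Suc k) = (\<lambda>(i, w). i # w) ` ({1..m} \<times> words m k)"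
  by (auto simp: words_def length_Suc_conv image_iff)

lemma sum_words_Suc: "(\<Sum>w\<in>words m (Suc k). f w) = (\<Sum>i=1..m. \<Sum>w\<in>words m k. f (i # w))"
proof -
  have "inj_on (\<lambda>(i, w). i # w) ({1..m} \<times> words m k)" by (auto simp: inj_on_def)
  then show ?thesis
    by (simp add: words_Suc sum.reindex sum.cartesian_product case_prod_unfold)
qed

lemma kraus_map_Herm: "X \<in> Herm \<Longrightarrow> kraus_map V m X \<in> Herm"
  by (simp add: kraus_map_def Herm_iff ctranspose_sum ctranspose_mult matrix_mul_assoc)

lemma qform_kraus_map: "qform (kraus_map V m X) x = (\<Sum>i=1..m. qform X (V i *v x))"
  by (simp add: kraus_map_def qform_sum qform_conj)

lemma kraus_iter_Herm: "X \<in> Herm \<Longrightarrow> (kraus_map V m ^^ k) X \<in> Herm"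
  by (induction k) (simp_all add: kraus_map_Herm)

lemma qform_kraus_iter:
  "qform ((kraus_map V m ^^ k) X) x = (\<Sum>w\<in>words m k. qform X (wprod V w *v x))"
  by (induction k arbitrary: x)
     (simp_all add: words_0 sum_words_Suc qform_kraus_map matrix_vector_mul_assoc)

section \<open>Contraction of the oscillation\<close>

locale unital_kraus =
  fixes V :: "nat \<Rightarrow> complex^'n^'n" and m :: nat
  assumes unital: "(\<Sum>i = 1..m. ctranspose (V i) ** V i) = mat 1"
begin

abbreviation iter :: "nat \<Rightarrow> complex^'n^'n \<Rightarrow> complex^'n^'n"
  where "iter k \<equiv> kraus_map V m ^^ k"

lemma kraus_map_unital: "kraus_map V m (mat 1) = mat 1"
  using unital by (simp add: kraus_map_def)

lemma iter_unital: "iter k (mat 1) = mat 1"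
  by (induction k) (simp_all add: kraus_map_unital)

text \<open>Because of this identity the quadratic form of \<open>iter k X\<close> at a unit vector is a weighted average of
Rayleigh quotients of \<open>X\<close>.\<close>

lemma sum_words_norm: "(\<Sum>w\<in>words m k. (norm (wprod V w *v x))\<^sup>2) = (norm x)\<^sup>2"
  using qform_kraus_iter[where X = "mat 1" and V = V and m = m and k = k and x = x]
  by (simp add: iter_unital qform_mat_1)

lemma iter_scalar:
  assumes "X \<in> real_scalars" shows "iter k X = X"
proof -
  obtain r where X: "X = r *\<^sub>R mat 1" using assms by (auto simp: real_scalars_def)
  show ?thesis unfolding X
    by (intro Herm_eqI kraus_iter_Herm scaleR_mat_1_Herm)
       (simp add: qform_kraus_iter qform_scalar sum_distrib_left[symmetric] sum_words_norm)
qed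

lemma iter_lambda_bounds:
  assumes X: "X \<in> Herm"
  shows "lambda_max (iter k X) \<le> lambda_max X" "lambda_min X \<le> lambda_min (iter k X)"
proof -
  have FX: "iter k X \<in> Herm" using X by (rule kraus_iter_Herm)
  have "qform (iter k X) x \<le> (\<Sum>w\<in>words m k. lambda_max X * (norm (wprod V w *v x))\<^sup>2)" for x
    unfolding qform_kraus_iter by (intro sum_mono lambda_max_Rayleigh(2) X)
  then have up: "qform (iter k X) x \<le> lambda_max X * (norm x)\<^sup>2" for x
    by (simp add: sum_distrib_left[symmetric] sum_words_norm)
  obtain x where x: "norm x = 1" "qform (iter k X) x = lambda_max (iter k X)"
    using lambda_max_Rayleigh(1)[OF FX] by blast
  show "lambda_max (iter k X) \<le> lambda_max X" using up[of x] x by simp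
  have "(\<Sum>w\<in>words m k. lambda_min X * (norm (wprod V w *v x))\<^sup>2) \<le> qform (iter k X) x" for x
    unfolding qform_kraus_iter by (intro sum_mono lambda_min_Rayleigh(2) X)
  then have low: "lambda_min X * (norm x)\<^sup>2 \<le> qform (iter k X) x" for x
    by (simp add: sum_distrib_left[symmetric] sum_words_norm)
  obtain y where y: "norm y = 1" "qform (iter k X) y = lambda_min (iter k X)"
    using lambda_min_Rayleigh(1)[OF FX] by blast
  show "lambda_min X \<le> lambda_min (iter k X)" using low[of y] y by simp
qed

lemma osc_iter_le: "X \<in> Herm \<Longrightarrow> osc (iter k X) \<le> osc X"
  using iter_lambda_bounds[of X k] by (simp add: osc_def)

text \<open>The supremum in \<open>hnorm\<close> is only informative because the quotients are bounded by 1. Scalar matrices,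
which include all Hermitian matrices in dimension 1, lie outside its index set and satisfy the
inequality because both sides vanish.\<close>

lemma hnorm_less_1_contraction:
  assumes "hnorm (iter k) < 1"
  shows "\<exists>c<1. \<forall>X\<in>Herm. osc (iter k X) \<le> c * osc X"
proof (intro exI conjI ballI)
  show "hnorm (iter k) < 1" by fact
  fix X :: "complex^'n^'n" assume X: "X \<in> Herm"
  show "osc (iter k X) \<le> hnorm (iter k) * osc X"
  proof (cases "X \<in> real_scalars")
    case True
    then show ?thesis by (simp add: iter_scalar osc_scalar)
  next
    case False
    then have "CARD('n) \<noteq> 1" using Herm_dim_1 X by blast
    then have h: "hnorm (iter k) = (SUP X \<in> Herm - real_scalars. osc (iter k X) / osc X)"
      by (simp add: hnorm_def osc_def)
    have "osc (iter k Y) / osc Y \<le> 1" if "Y \<in> Herm - real_scalars" for Y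
      using osc_pos[OF that] osc_iter_le[of Y k] that by simp
    then have "bdd_above ((\<lambda>X. osc (iter k X) / osc X) ` (Herm - real_scalars))"
      by (rule bdd_aboveI2)
    then have "osc (iter k X) / osc X \<le> hnorm (iter k)"
      unfolding h using X False by (intro cSUP_upper) auto
    then show ?thesis using osc_pos[of X] X False by (simp add: pos_divide_le_eq)
  qed
qed

text \<open>Along an orbit the largest eigenvalue decreases and the smallest increases. In the limit the
inequality \<open>osc X\<^bsub>j+k\<^esub> \<le> c osc X\<^sub>j\<close> leaves no gap between their limits, and squeezing the quadratic
forms gives convergence of the matrices.\<close>

lemma contraction_imp_convergence:
  assumes h: "hnorm (iter k) < 1" and X: "X \<in> Herm"
  shows "\<exists>L. (\<lambda>j. iter j X) \<longlonglongrightarrow> L *\<^sub>R mat 1"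
proof -
  obtain c where c: "c < 1" "\<forall>X\<in>Herm. osc (iter k X) \<le> c * osc X"
    using hnorm_less_1_contraction[OF h] by blast
  define a where "a j = lambda_max (iter j X)" for j
  define b where "b j = lambda_min (iter j X)" for j
  have H: "iter j X \<in> Herm" for j using X by (rule kraus_iter_Herm)
  have dec: "decseq a"
    unfolding decseq_Suc_iff a_def using iter_lambda_bounds(1)[OF H, of 1] by simp
  have inc: "incseq b"
    unfolding incseq_Suc_iff b_def using iter_lambda_bounds(2)[where k = 1, OF H] by simp
  have ba: "b j \<le> a j" for j
    unfolding a_def b_def by (rule lambda_min_le_lambda_max[OF H])
  have "b 0 \<le> a j" for j using incseqD[OF inc, of 0 j] ba[of j] by simp
  then obtain L where L: "a \<longlonglongrightarrow> L" using decseq_convergent[OF dec] by blast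
  have "b j \<le> a 0" for j using decseqD[OF dec, of 0 j] ba[of j] by simp
  then obtain L' where L': "b \<longlonglongrightarrow> L'" using incseq_convergent[OF inc] by blast
  have le: "L' \<le> L" using ba by (intro LIMSEQ_le[OF L' L]) auto
  have iterk: "iter k (iter j X) = iter (j + k) X" for j
    by (simp add: funpow_add add.commute[of j k])
  have step: "a (j + k) - b (j + k) \<le> c * (a j - b j)" for j
    using bspec[OF c(2) H, of j] by (simp add: a_def b_def osc_def iterk)
  \<comment> \<open>Passing to the limit also covers \<open>k = 0\<close>, where iterating the contraction would not advance the orbit.\<close>
  have "L - L' \<le> c * (L - L')"
  proof (rule LIMSEQ_le)
    show "(\<lambda>j. a (j + k) - b (j + k)) \<longlonglongrightarrow> L - L'"
      by (intro tendsto_diff LIMSEQ_ignore_initial_segment L L')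
    show "(\<lambda>j. c * (a j - b j)) \<longlonglongrightarrow> c * (L - L')"
      by (intro tendsto_intros L L')
  qed (use step in auto)
  then have "(1 - c) * (L - L') \<le> 0" by (simp add: algebra_simps)
  then have eq: "L' = L" using c(1) le by (simp add: mult_le_0_iff)
  have "(\<lambda>j. iter j X) \<longlonglongrightarrow> L *\<^sub>R mat 1"
  proof (rule Herm_tendstoI[OF H scaleR_mat_1_Herm])
    fix x :: "complex^'n"
    have lim: "(\<lambda>j. b j * (norm x)\<^sup>2) \<longlonglongrightarrow> L * (norm x)\<^sup>2" "(\<lambda>j. a j * (norm x)\<^sup>2) \<longlonglongrightarrow> L * (norm x)\<^sup>2"
      using L L' eq by (auto intro: tendsto_mult_right)
    show "(\<lambda>j. qform (iter j X) x) \<longlonglongrightarrow> qform (L *\<^sub>R mat 1) x"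
      unfolding qform_scalar
      by (rule tendsto_sandwich[OF _ _ lim])
         (simp_all add: a_def b_def lambda_max_Rayleigh(2)[OF H] lambda_min_Rayleigh(2)[OF H])
  qed
  then show ?thesis by blast
qed

text \<open>For nonscalar Hermitian \<open>X\<close> the quotient \<open>osc (iter k X) / osc X\<close> is at most the value of the continuous function
\<open>(X, u, v) \<mapsto> \<langle>u, F X u\<rangle> - \<langle>v, F X v\<rangle>\<close>, \<open>F = iter k\<close>, at some triple of an effect and two unit vectors. Its
maximum over these triples is attained and at most 1. If it were 1, the effect would be 1 at every
\<open>W u\<close> and 0 at every \<open>W' v\<close>, so every \<open>W u\<close> would be orthogonal to every \<open>W' v\<close>.\<close>

lemma hnorm_less_1_if_no_orthogonal_words:
  assumes no_orth: "\<And>u v. u \<noteq> 0 \<Longrightarrow> v \<noteq> 0 \<Longrightarrow>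
      \<exists>w\<in>words m k. \<exists>w'\<in>words m k. cinner (wprod V w *v u) (wprod V w' *v v) \<noteq> 0"
  shows "hnorm (iter k) < 1"
proof (cases "CARD('n) = 1")
  case True
  then show ?thesis by (simp add: hnorm_def)
next
  case False
  define K :: "((complex^'n^'n) \<times> (complex^'n) \<times> (complex^'n)) set"
    where "K = effects \<times> sphere 0 1 \<times> sphere 0 1"
  define g where "g = (\<lambda>(X, u, v). qform (iter k X) u - qform (iter k X) v)"
  have K: "compact K"
    unfolding K_def by (intro compact_Times compact_effects compact_sphere)
  have "(mat 1, axis undefined 1, axis undefined 1) \<in> K"
    using scaleR_mat_1_Herm[of 1] by (simp add: K_def effects_def qform_mat_1 norm_eq_1 inner_axis_axis)
  then have "K \<noteq> {}" by blast
  moreover have "continuous_on K g"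
    unfolding g_def qform_kraus_iter case_prod_unfold
    by (intro continuous_intros linear_continuous_on_compose[OF _ matrix_vector_mul_linear])
  ultimately obtain s where s: "s \<in> K" "\<forall>t\<in>K. g t \<le> g s"
    using continuous_attains_sup[OF K] by blast
  obtain X u v where suv: "s = (X, u, v)" by (cases s)
  have X: "X \<in> effects" and u: "norm u = 1" and v: "norm v = 1"
    using s(1) by (auto simp: suv K_def)
  have q: "0 \<le> qform X x" "qform X x \<le> (norm x)\<^sup>2" for x using X by (auto simp: effects_def)
  have fin: "finite (words m k)"
    unfolding words_def by (rule finite_lists_length_eq) simp
  have less: "g s < 1"
  proof (rule ccontr)
    assume "\<not> g s < 1"
    moreover have "qform (iter k X) u \<le> 1"
      using sum_mono[OF q(2), of "\<lambda>w. wprod V w *v u" "words m k"]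
      by (simp add: qform_kraus_iter sum_words_norm u)
    moreover have "0 \<le> qform (iter k X) v"
      unfolding qform_kraus_iter by (intro sum_nonneg q)
    ultimately have 1: "qform (iter k X) u = 1" and 0: "qform (iter k X) v = 0"
      by (auto simp: g_def suv)
    have v0: "\<forall>w\<in>words m k. qform X (wprod V w *v v) = 0"
      using 0 fin q(1) unfolding qform_kraus_iter by (subst (asm) sum_nonneg_eq_0_iff) auto
    have "(\<Sum>w\<in>words m k. (norm (wprod V w *v u))\<^sup>2 - qform X (wprod V w *v u)) = 0"
      using 1 by (simp add: sum_subtractf sum_words_norm u qform_kraus_iter)
    then have u1: "\<forall>w\<in>words m k. qform X (wprod V w *v u) = (norm (wprod V w *v u))\<^sup>2"
      using fin q(2) by (subst (asm) sum_nonneg_eq_0_iff) auto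
    have "u \<noteq> 0" "v \<noteq> 0" using u v by auto
    then obtain w w' where w: "w \<in> words m k" "w' \<in> words m k"
      "cinner (wprod V w *v u) (wprod V w' *v v) \<noteq> 0"
      using no_orth by blast
    then show False using cinner_effects_eq_0[OF X bspec[OF u1 w(1)] bspec[OF v0 w(2)]] by simp
  qed
  have ratio: "osc (iter k Y) / osc Y \<le> g s" if Y: "Y \<in> Herm - real_scalars" for Y
  proof -
    have H: "Y \<in> Herm" and pos: "0 < osc Y" using Y osc_pos by auto
    define Z where "Z = (1 / osc Y) *\<^sub>R (Y - lambda_min Y *\<^sub>R mat 1)"
    have Z: "Z \<in> effects" unfolding Z_def by (rule effects_normalisation[OF H pos])
    obtain x y where xy: "norm x = 1" "norm y = 1"
      and o: "osc (iter k Y) = qform (iter k Y) x - qform (iter k Y) y"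
      using osc_attained[OF kraus_iter_Herm[OF H]] by blast
    \<comment> \<open>The shift by a scalar matrix cancels in differences and the factor \<open>1 / osc Y\<close> remains.\<close>
    have q: "qform (iter k Z) z = (qform (iter k Y) z - lambda_min Y) / osc Y" if "norm z = 1" for z
      using that sum_words_norm[where k = k and x = z]
      by (simp add: Z_def qform_kraus_iter qform_scaleR qform_diff qform_mat_1 sum_subtractf
          sum_divide_distrib[symmetric] sum_distrib_left[symmetric] diff_divide_distrib)
    have "osc (iter k Y) / osc Y = g (Z, x, y)"
      using q[OF xy(1)] q[OF xy(2)] by (simp add: g_def o diff_divide_distrib)
    also have "\<dots> \<le> g s" using s(2) Z xy by (simp add: K_def)
    finally show ?thesis .
  qed
  have "hnorm (iter k) = (SUP X \<in> Herm - real_scalars. osc (iter k X) / osc X)"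
    using False by (simp add: hnorm_def osc_def)
  also have "\<dots> \<le> g s"
    by (intro cSUP_least Herm_nonscalar_exists[OF False] ratio)
  finally show ?thesis using less by simp
qed

end

section \<open>The chain of spaces and their orthogonal complements\<close>

text \<open>As long as the inclusions are strict, an independent subset of the chain can be extended by one
vector at each step, and it has one element at the start. This first element is
what makes \<open>j\<close> smaller than \<open>card B\<close>, and thus bounds the exponent by \<open>n\<^sup>2 - 1\<close> rather than by \<open>n\<^sup>2\<close>.\<close>

lemma (in vector_space) ascending_subspaces_stabilise:
  assumes sub: "\<And>k. subspace (S k)" and mono: "\<And>k. S k \<subseteq> S (Suc k)"
    and B: "finite B" "span B = UNIV" and x: "x \<in> S 0" "x \<noteq> 0"
  shows "\<exists>j<card B. S j = S (Suc j)"
proof (rule ccontr)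
  assume none: "\<not> (\<exists>j<card B. S j = S (Suc j))"
  have "\<exists>C\<subseteq>S k. finite C \<and> independent C \<and> card C = Suc k" if "k \<le> card B" for k
    using that
  proof (induction k)
    case 0
    have "independent {x}" using x(2) by (simp add: dependent_single)
    then show ?case using x(1) by (intro exI[of _ "{x}"]) simp
  next
    case (Suc k)
    then obtain C where C: "C \<subseteq> S k" "finite C" "independent C" "card C = Suc k" by auto
    have "S k \<noteq> S (Suc k)" using none Suc.prems by auto
    then obtain y where y: "y \<in> S (Suc k)" "y \<notin> S k" using mono by blast
    have "y \<notin> span C" using y(2) span_minimal[OF C(1) sub] by blast
    then have "independent (insert y C)" "y \<notin> C"
      using C(3) independent_insertI span_base by blast+
    then show ?case
      using C y(1) mono by (intro exI[of _ "insert y C"]) auto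
  qed
  then obtain C where "independent C" "card C = Suc (card B)" by blast
  then show False using independent_span_bound[OF B(1), of C] B(2) by simp
qed

lemma cmatrix_units_span:
  "cmatrix.span (range (\<lambda>(i, j). axis i (axis j 1))) = (UNIV :: (complex^'n^'m) set)"
proof (intro set_eqI iffI UNIV_I)
  fix A :: "complex^'n^'m"
  let ?E = "\<lambda>(i, j). axis i (axis j 1) :: complex^'n^'m"
  have entry: "cscale c (?E (i, j)) $ k $ l = (if i = k then if j = l then c else 0 else 0)" for c i j k l
    by (auto simp: cscale_def axis_def)
  have row: "(\<Sum>j\<in>UNIV. if i = k then if j = l then A $ i $ j else 0 else 0)
      = (if i = k then A $ i $ l else 0)" for i k l
    by simp
  have "A = (\<Sum>i\<in>UNIV. \<Sum>j\<in>UNIV. cscale (A $ i $ j) (?E (i, j)))"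
    unfolding vec_eq_iff sum_component entry row by simp
  moreover have "\<dots> \<in> cmatrix.span (range ?E)"
    by (intro cmatrix.span_sum cmatrix.span_scale cmatrix.span_base) auto
  ultimately show "A \<in> cmatrix.span (range ?E)" by simp
qed

lemma orth_span_iff:
  "(\<forall>B\<in>cmatrix.span S. cinner (B *v u) v = 0) \<longleftrightarrow> (\<forall>B\<in>S. cinner (B *v u) v = 0)"
proof
  assume S: "\<forall>B\<in>S. cinner (B *v u) v = 0"
  have "cmatrix.subspace {B. cinner (B *v u) v = 0}"
    by (auto simp: cmatrix.subspace_def matrix_vector_mult_add_rdistrib cscale_mult_vec
        cinner_add_left cinner_scale_left) (simp add: cinner_def)
  then have "cmatrix.span S \<subseteq> {B. cinner (B *v u) v = 0}"
    using S by (intro cmatrix.span_minimal) auto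
  then show "\<forall>B\<in>cmatrix.span S. cinner (B *v u) v = 0" by blast
qed (use cmatrix.span_base in blast)

text \<open>Peeling one letter off both words corresponds to one step of the recursion for \<open>Hspace\<close>, by
\<open>\<langle>V\<^sub>i\<^sup>* X V\<^sub>j u, v\<rangle> = \<langle>X V\<^sub>j u, V\<^sub>i v\<rangle>\<close>.\<close>

lemma orth_Hspace_iff:
  "(\<forall>B\<in>Hspace V m k. cinner (B *v u) v = 0) \<longleftrightarrow>
   (\<forall>w\<in>words m k. \<forall>w'\<in>words m k. cinner (wprod V w *v u) (wprod V w' *v v) = 0)"
proof (induction k arbitrary: u v)
  case 0
  then show ?case by (simp add: orth_span_iff words_0)
next
  case (Suc k)
  have gen: "cinner ((ctranspose (V i) ** X ** V j) *v u) v = cinner (X *v (V j *v u)) (V i *v v)" for X i j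
    by (simp add: matrix_vector_mul_assoc[symmetric] cinner_adjoint)
  have "(\<forall>B\<in>Hspace V m (Suc k). cinner (B *v u) v = 0) \<longleftrightarrow>
    (\<forall>i\<in>{1..m}. \<forall>j\<in>{1..m}. \<forall>X\<in>Hspace V m k. cinner (X *v (V j *v u)) (V i *v v) = 0)"
    unfolding Hspace.simps orth_span_iff gen[symmetric] by blast
  also have "\<dots> \<longleftrightarrow> (\<forall>w\<in>words m (Suc k). \<forall>w'\<in>words m (Suc k).
      cinner (wprod V w *v u) (wprod V w' *v v) = 0)"
    unfolding Suc.IH words_Suc by (auto simp: matrix_vector_mul_assoc)
  finally show ?case .
qed

text \<open>The rank one matrices in the orthogonal complement encode the pairs of vectors that the Kraus
operators of the \<open>k\<close>-th iterate keep mutually orthogonal.\<close>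

lemma outer_in_Gspace_iff:
  "outer v u \<in> Gspace V m k \<longleftrightarrow>
   (\<forall>w\<in>words m k. \<forall>w'\<in>words m k. cinner (wprod V w *v u) (wprod V w' *v v) = 0)"
  unfolding orth_Hspace_iff[symmetric] by (simp add: Gspace_def orth_compl_def trace_inner_outer)

lemma Gspace_antimono: "Hspace V m k \<subseteq> Hspace V m l \<Longrightarrow> Gspace V m l \<subseteq> Gspace V m k"
  by (auto simp: Gspace_def orth_compl_def)

lemma Hspace_subspace: "cmatrix.subspace (Hspace V m k)"
  by (cases k) simp_all

context unital_kraus
begin

text \<open>Unitality puts the identity into the first space of the chain after the start; the recursion then
propagates the inclusion.\<close>

lemma Hspace_Suc_mono: "Hspace V m k \<subseteq> Hspace V m (Suc k)"
proof (induction k)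
  case 0
  have "ctranspose (V i) ** mat 1 ** V i \<in> Hspace V m (Suc 0)" if "i \<in> {1..m}" for i
  proof -
    have "mat 1 \<in> cmatrix.span {mat 1 :: complex^'n^'n}" by (simp add: cmatrix.span_base)
    then show ?thesis
      unfolding Hspace.simps using that by (intro cmatrix.span_base) blast
  qed
  then have "(\<Sum>i=1..m. ctranspose (V i) ** V i) \<in> Hspace V m (Suc 0)"
    by (intro cmatrix.subspace_sum Hspace_subspace) simp
  then have "mat 1 \<in> Hspace V m (Suc 0)" by (simp only: unital)
  then show ?case
    using cmatrix.span_minimal[OF _ Hspace_subspace, of "{mat 1}" V m "Suc 0"] by simp
next
  case (Suc k)
  show ?case
    by (subst (1 2) Hspace.simps(2), rule cmatrix.span_mono) (use Suc in blast)
qed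

lemma Hspace_mono: "k \<le> l \<Longrightarrow> Hspace V m k \<subseteq> Hspace V m l"
  by (rule lift_Suc_mono_le) (rule Hspace_Suc_mono)

text \<open>Each space determines the next one, so one equality in the chain makes it constant from there on.\<close>

lemma Hspace_stabilises: "Hspace V m k \<subseteq> Hspace V m ((CARD('n))\<^sup>2 - 1)"
proof -
  let ?E = "\<lambda>(i, j). axis i (axis j 1) :: complex^'n^'n"
  have m1: "mat 1 \<in> Hspace V m 0" by (simp add: cmatrix.span_base)
  have m10: "(mat 1 :: complex^'n^'n) \<noteq> 0"
    by (auto simp: vec_eq_iff mat_def)
  obtain j where j: "j < card (range ?E)" "Hspace V m j = Hspace V m (Suc j)"
    using cmatrix.ascending_subspaces_stabilise[OF Hspace_subspace Hspace_Suc_mono _ cmatrix_units_span m1 m10]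
    by auto
  have "card (range ?E) \<le> (CARD('n))\<^sup>2"
    using card_image_le[of UNIV ?E] by (simp add: power2_eq_square)
  then have jle: "j \<le> (CARD('n))\<^sup>2 - 1" using j(1) by simp
  have stable: "Hspace V m (j + i) = Hspace V m j" for i
  proof (induction i)
    case (Suc i)
    have "Hspace V m (Suc (j + i)) = Hspace V m (Suc j)"
      by (simp only: Hspace.simps Suc.IH)
    then show ?case by (simp only: add_Suc_right j(2)[symmetric])
  qed simp
  have "Hspace V m k \<subseteq> Hspace V m (j + k)" by (rule Hspace_mono) simp
  also have "\<dots> = Hspace V m j" by (rule stable)
  also have "\<dots> \<subseteq> Hspace V m ((CARD('n))\<^sup>2 - 1)" by (rule Hspace_mono[OF jle])
  finally show ?thesis .
qed

section \<open>Nonconvergent orbits from orthogonal pairs\<close>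

text \<open>Let \<open>\<rho>\<^sub>k\<close> and \<open>\<sigma>\<^sub>k\<close> be the images of \<open>u u\<^sup>*\<close> and \<open>v v\<^sup>*\<close> under the \<open>k\<close>-th iterate of the adjoint map. If all orbits
converge to scalar matrices, the difference \<open>\<rho>\<^sub>k - \<sigma>\<^sub>k\<close> tends to 0 against every Hermitian matrix, hence in
norm. But the hypothesis makes \<open>\<rho>\<^sub>k\<close> and \<open>\<sigma>\<^sub>k\<close> orthogonal, while \<open>\<rho>\<^sub>k\<close> keeps trace 1 and so has norm at least
\<open>1 / |I|\<close>; therefore their difference stays away from 0.\<close>

lemma orth_words_not_convergent:
  assumes u: "norm u = 1" and v: "norm v = 1"
    and orth: "\<And>k w w'. w \<in> words m k \<Longrightarrow> w' \<in> words m k \<Longrightarrow>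
      cinner (wprod V w *v u) (wprod V w' *v v) = 0"
  shows "\<exists>X\<in>Herm. \<forall>L. \<not> (\<lambda>j. iter j X) \<longlonglongrightarrow> L *\<^sub>R mat 1"
proof (rule ccontr)
  assume "\<not> ?thesis"
  then have conv: "\<exists>L. (\<lambda>j. iter j X) \<longlonglongrightarrow> L *\<^sub>R mat 1" if "X \<in> Herm" for X
    using that by blast
  define \<rho> where "\<rho> x k = (\<Sum>w\<in>words m k. outer (wprod V w *v x) (wprod V w *v x))" for x k
  have \<rho>: "\<rho> x k \<bullet> X = (\<Sum>w\<in>words m k. qform X (wprod V w *v x))" for x k X
    by (simp add: \<rho>_def inner_sum_left outer_self_inner)
  define D where "D k = \<rho> u k - \<rho> v k" for k
  have D_Herm: "(\<lambda>k. D k \<bullet> X) \<longlonglongrightarrow> 0" if X: "X \<in> Herm" for X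
  proof -
    obtain L where L: "(\<lambda>j. iter j X) \<longlonglongrightarrow> L *\<^sub>R mat 1" using conv[OF X] by blast
    have "(\<lambda>k. outer u u \<bullet> iter k X - outer v v \<bullet> iter k X) \<longlonglongrightarrow>
        outer u u \<bullet> (L *\<^sub>R mat 1) - outer v v \<bullet> (L *\<^sub>R mat 1)"
      by (intro tendsto_intros L)
    then show ?thesis
      using u v by (simp add: outer_self_inner qform_kraus_iter qform_scaleR qform_mat_1 D_def inner_diff_left \<rho>)
  qed
  \<comment> \<open>The matrices \<open>D k\<close> are Hermitian and so see only the Hermitian part of \<open>X\<close>. Arbitrary \<open>X\<close> are
    needed to reach the whole standard basis and thereby convergence in norm.\<close>
  have D_all: "(\<lambda>k. D k \<bullet> X) \<longlonglongrightarrow> 0" for X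
  proof -
    have "X + ctranspose X \<in> Herm" by (simp add: Herm_iff ctranspose_add add.commute)
    then have "(\<lambda>k. (D k \<bullet> (X + ctranspose X)) / 2) \<longlonglongrightarrow> 0 / 2"
      by (intro tendsto_divide D_Herm tendsto_const) simp_all
    moreover have "D k \<bullet> ctranspose X = D k \<bullet> X" for k
      by (simp add: D_def inner_diff_left \<rho> qform_ctranspose)
    ultimately show ?thesis by (simp add: inner_add_right)
  qed
  have D0: "D \<longlonglongrightarrow> 0"
    by (subst tendsto_componentwise_iff) (use D_all in simp)
  have lower: "1 \<le> norm (D k) * norm (mat 1 :: complex^'n^'n)" for k
  proof -
    have "qform (outer y y) x = 0" if "cinner x y = 0" for x y :: "complex^'n"
      using that cinner_commute[of y x] by (simp add: qform_def outer_mult_vec)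
    then have "\<rho> u k \<bullet> \<rho> v k = 0"
      unfolding \<rho> by (intro sum.neutral ballI) (auto simp: \<rho>_def qform_sum intro!: sum.neutral orth)
    \<comment> \<open>Subtracting the orthogonal matrix \<open>\<rho> v k\<close> cannot bring \<open>\<rho> u k\<close> closer to 0.\<close>
    then have "(norm (\<rho> u k))\<^sup>2 = \<rho> u k \<bullet> D k"
      by (simp add: D_def inner_diff_right power2_norm_eq_inner)
    also have "\<dots> \<le> norm (\<rho> u k) * norm (D k)" by (rule norm_cauchy_schwarz)
    finally have le: "norm (\<rho> u k) \<le> norm (D k)"
      by (cases "\<rho> u k = 0") (simp_all add: power2_eq_square)
    have "1 = \<rho> u k \<bullet> mat 1"
      unfolding \<rho> by (simp add: qform_mat_1 sum_words_norm u)
    also have "\<dots> \<le> norm (\<rho> u k) * norm (mat 1 :: complex^'n^'n)" by (rule norm_cauchy_schwarz)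
    also have "\<dots> \<le> norm (D k) * norm (mat 1 :: complex^'n^'n)"
      using le by (intro mult_right_mono) simp_all
    finally show ?thesis .
  qed
  have "(\<lambda>k. norm (D k) * norm (mat 1 :: complex^'n^'n)) \<longlonglongrightarrow> norm (0 :: complex^'n^'n) * norm (mat 1 :: complex^'n^'n)"
    by (intro tendsto_intros D0)
  then have "1 \<le> norm (0 :: complex^'n^'n) * norm (mat 1 :: complex^'n^'n)"
    using lower by (intro LIMSEQ_le_const) auto
  then show False by simp
qed

end

section \<open>The equivalence\<close>

theorem theorem7p7:
  fixes V :: "nat \<Rightarrow> complex^'n^'n" and m :: nat
    and \<Phi> :: "complex^'n^'n \<Rightarrow> complex^'n^'n"
    and C1 C2 C3 C4 :: bool
  assumes unital: "(\<Sum>i = 1..m. ctranspose (V i) ** V i) = mat 1"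
  defines "\<Phi> \<equiv> kraus_map V m"
  defines "C1 \<equiv> (\<exists>k. hnorm (\<Phi> ^^ k) < 1)"
    and "C2 \<equiv> (\<forall>X :: nat \<Rightarrow> complex^'n^'n.
             (\<forall>k\<ge>1. X k \<in> Herm \<and> X (Suc k) = \<Phi> (X k)) \<longrightarrow>
             (\<exists>E \<in> real_scalars. \<Phi> E = E \<and> X \<longlonglongrightarrow> E))"
    and "C3 \<equiv> \<not> (\<exists>A \<in> (\<Inter>k. Gspace V m k). rank A = 1)"
    and "C4 \<equiv> (\<exists>k\<^sub>0 \<le> (CARD('n))\<^sup>2 - 1. hnorm (\<Phi> ^^ k\<^sub>0) < 1)"
  shows "(C1 \<longleftrightarrow> C2) \<and> (C2 \<longleftrightarrow> C3) \<and> (C3 \<longleftrightarrow> C4)"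
proof -
  interpret unital_kraus V m by unfold_locales (rule unital)
  have C12: C2 if C1
    unfolding C2_def
  proof (intro allI impI)
    fix X :: "nat \<Rightarrow> complex^'n^'n"
    assume X: "\<forall>k\<ge>1. X k \<in> Herm \<and> X (Suc k) = \<Phi> (X k)"
    obtain k where k: "hnorm (iter k) < 1" using \<open>C1\<close> by (auto simp: C1_def \<Phi>_def)
    \<comment> \<open>The recursion relates the terms from index 1 on, so the limit is read off the shifted sequence.\<close>
    have orbit: "X (Suc j) = iter j (X 1)" for j
    proof (induction j)
      case (Suc j)
      have "X (Suc (Suc j)) = \<Phi> (X (Suc j))" using X by simp
      with Suc show ?case by (simp add: \<Phi>_def)
    qed simp
    have "X 1 \<in> Herm" using X by simp
    then obtain L where "(\<lambda>j. iter j (X 1)) \<longlonglongrightarrow> L *\<^sub>R mat 1"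
      using contraction_imp_convergence[OF k] by blast
    then have "X \<longlonglongrightarrow> L *\<^sub>R mat 1"
      by (subst filterlim_sequentially_Suc[symmetric]) (simp only: orbit)
    moreover have "L *\<^sub>R mat 1 \<in> real_scalars" unfolding real_scalars_def by (rule rangeI)
    moreover from this have "\<Phi> (L *\<^sub>R mat 1) = L *\<^sub>R mat 1"
      using iter_scalar[where k = 1] by (simp add: \<Phi>_def)
    ultimately show "\<exists>E\<in>real_scalars. \<Phi> E = E \<and> X \<longlonglongrightarrow> E" by blast
  qed
  have C23: C3 if C2
    unfolding C3_def
  proof
    assume "\<exists>A\<in>(\<Inter>k. Gspace V m k). rank A = 1"
    then obtain A where A: "\<And>k. A \<in> Gspace V m k" "rank A = 1" by blast
    obtain v u where vu: "v \<noteq> 0" "u \<noteq> 0" "A = outer v u" using rank_1_is_outer[OF A(2)] by blast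
    define u' v' where "u' = (1 / norm u) *\<^sub>R u" and "v' = (1 / norm v) *\<^sub>R v"
    have scale: "cinner (a *\<^sub>R x) (b *\<^sub>R y) = of_real (a * b) * cinner x y" for a b and x y :: "complex^'n"
      by (simp add: cinner_def scaleR_conv_of_real[where 'a=complex] sum_distrib_left mult_ac)
    have "cinner (wprod V w *v u') (wprod V w' *v v') = 0" if "w \<in> words m k" "w' \<in> words m k" for k w w'
      using A(1)[of k] that by (simp add: u'_def v'_def mult_vec_scaleR scale vu(3) outer_in_Gspace_iff)
    moreover have "norm u' = 1" "norm v' = 1" using vu by (simp_all add: u'_def v'_def)
    ultimately have "\<exists>X\<in>Herm. \<forall>L. \<not> (\<lambda>j. iter j X) \<longlonglongrightarrow> L *\<^sub>R mat 1"
      by (intro orth_words_not_convergent)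
    then obtain X where X: "X \<in> Herm" "\<forall>L. \<not> (\<lambda>j. iter j X) \<longlonglongrightarrow> L *\<^sub>R mat 1"
      by blast
    have "\<forall>k\<ge>1. iter k X \<in> Herm \<and> iter (Suc k) X = \<Phi> (iter k X)"
      using X(1) by (simp add: \<Phi>_def kraus_iter_Herm)
    with \<open>C2\<close>[unfolded C2_def, THEN spec, of "\<lambda>j. iter j X"]
    have "\<exists>E\<in>real_scalars. \<Phi> E = E \<and> (\<lambda>j. iter j X) \<longlonglongrightarrow> E" by (rule mp)
    then show False using X(2) by (auto simp: real_scalars_def)
  qed
  have C34: C4 if C3
  proof -
    \<comment> \<open>A rank one matrix orthogonal to the last, largest space is orthogonal to the entire chain.\<close>
    let ?N = "(CARD('n))\<^sup>2 - 1"
    have "\<exists>w\<in>words m ?N. \<exists>w'\<in>words m ?N. cinner (wprod V w *v u) (wprod V w' *v v) \<noteq> 0"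
      if uv: "u \<noteq> 0" "v \<noteq> 0" for u v
    proof (rule ccontr)
      assume "\<not> ?thesis"
      then have "outer v u \<in> Gspace V m ?N" by (auto simp: outer_in_Gspace_iff)
      then have "outer v u \<in> Gspace V m k" for k
        using Gspace_antimono[OF Hspace_stabilises] by blast
      then show False using \<open>C3\<close> rank_outer[OF uv(2,1)] unfolding C3_def by blast
    qed
    then have "hnorm (iter ?N) < 1" by (rule hnorm_less_1_if_no_orthogonal_words)
    then show C4 unfolding C4_def \<Phi>_def by blast
  qed
  have C41: C1 if C4
    using that unfolding C1_def C4_def by blast
  show ?thesis using C12 C23 C34 C41 by blast
qed

end
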